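(* Let $\mathcal{M}=(E,\mathcal{C})$ be an oriented matroid of rank $r\geq 1$, let $e\in E$, and let $B,B'$ be $e$-embracing bases of $\mathcal{M}$. If $C(B,e)=C(B',e)$, then $d_e(B,B')=|B\setminus B'|$. If $C(B,e)\neq C(B',e)$, then $$d_{G(P_{\mathcal{M}^*,e})}(C(B,e),C(B',e))\leq d_e(B,B')\leq r\, d_{G(P_{\mathcal{M}^*,e})}(C(B,e),C(B',e)).$$ Moreover, in this latter case, if all circuits in $\mathcal{C}^+_e$ have support of size $r+1$, then the lower bound is attained with equality, i.e. $d_e(B,B')=d_{G(P_{\mathcal{M}^*,e})}(C(B,e),C(B',e))$.
   Context: Oriented matroids have finite ground set $E$ and are given by their set $\mathcal{C}$ of signed circuits; $\underline{X}$ denotes the support of a signed set $X$. A circuit $X\in\mathcal{C}$ is positive if $X(f)\ge 0$ (i.e. $X(f)\in\{0,+\}$) for all $f\in E$; $\mathcal{C}^+$ is the set of positive circuits and $\mathcal{C}_e^+=\{X\in\mathcal{C}^+ : X(e)=+\}$ is the set of $e$-positive circuits. For a basis $B$ (of the underlying matroid) with $e\notin B$, the fundamental circuit $C(B,e)$ is the unique $X\in\mathcal{C}$ with $\underline{X}\subseteq B\cup\{e\}$ and $X(e)=+$. The basis $B$ (with $e\notin B$) is $e$-embracing if $C(B,e)\in\mathcal{C}_e^+$. The $e$-embracing distance $d_e(B,B')$ of two $e$-embracing bases is the minimum $k$ such that there is a sequence $B=B_0,B_1,\ldots,B_k=B'$ of $e$-embracing bases with $|B_{i-1}\Delta B_i|=2$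 for all $i\in\{1,\dots,k\}$ ($\infty$ if there is none). The graph $G(P_{\mathcal{M}^*,e})$ (the 1-skeleton of the oriented matroid polyhedron of the affine oriented matroid $(\mathcal{M}^*,e)$, where $\mathcal{M}^*$ is the dual) has vertex set $\mathcal{C}_e^+$, and two distinct $X,X'\in\mathcal{C}_e^+$ are adjacent if and only if every $Z\in\mathcal{C}^+$ with $\underline{Z}\subseteq\underline{X}\cup\underline{X'}$ satisfies $Z\in\{X,X'\}$. $d_G$ denotes the graph distance in $G$. *)

theory Defs
  imports Main "HOL-Library.Extended_Nat"
begin

text \<open>
  A signed subset of \<open>E\<close> is a function with values in \<open>{-1, 0, 1}\<close>. It vanishes
  outside \<open>E\<close>, so that equality of signed sets is equality of functions.
\<close>

definition signed_set :: "'a set \<Rightarrow> ('a \<Rightarrow> int) \<Rightarrow> bool" where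
  "signed_set E X \<longleftrightarrow> (\<forall>f. X f \<in> {-1, 0, 1}) \<and> (\<forall>f. f \<notin> E \<longrightarrow> X f = 0)"

definition supp :: "('a \<Rightarrow> int) \<Rightarrow> 'a set" where
  "supp X = {f. X f \<noteq> 0}"

definition opp :: "('a \<Rightarrow> int) \<Rightarrow> 'a \<Rightarrow> int" where
  "opp X = (\<lambda>f. - X f)"

definition pos_part :: "('a \<Rightarrow> int) \<Rightarrow> 'a set" where
  "pos_part X = {f. X f > 0}"

definition neg_part :: "('a \<Rightarrow> int) \<Rightarrow> 'a set" where
  "neg_part X = {f. X f < 0}"

text \<open>The signed circuit axioms, with weak elimination.\<close>

locale oriented_matroid =
  fixes E :: "'a set" and \<C> :: "('a \<Rightarrow> int) set"
  assumes finite_ground: "finite E"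
    and signed: "X \<in> \<C> \<Longrightarrow> signed_set E X"
    and nonempty: "X \<in> \<C> \<Longrightarrow> supp X \<noteq> {}"
    and symmetric: "X \<in> \<C> \<Longrightarrow> opp X \<in> \<C>"
    and incomparable: "X \<in> \<C> \<Longrightarrow> Y \<in> \<C> \<Longrightarrow> supp X \<subseteq> supp Y \<Longrightarrow> X = Y \<or> X = opp Y"
    and elimination:
      "X \<in> \<C> \<Longrightarrow> Y \<in> \<C> \<Longrightarrow> X \<noteq> opp Y \<Longrightarrow> f \<in> pos_part X \<inter> neg_part Y \<Longrightarrow>
        \<exists>Z\<in>\<C>. pos_part Z \<subseteq> (pos_part X \<union> pos_part Y) - {f} \<and>
              neg_part Z \<subseteq> (neg_part X \<union> neg_part Y) - {f}"

definition indep :: "'a set \<Rightarrow> ('a \<Rightarrow> int) set \<Rightarrow> 'a set \<Rightarrow> bool" where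
  "indep E \<C> I \<longleftrightarrow> I \<subseteq> E \<and> (\<forall>X\<in>\<C>. \<not> supp X \<subseteq> I)"

definition basis :: "'a set \<Rightarrow> ('a \<Rightarrow> int) set \<Rightarrow> 'a set \<Rightarrow> bool" where
  "basis E \<C> B \<longleftrightarrow> indep E \<C> B \<and> (\<forall>I. indep E \<C> I \<and> B \<subseteq> I \<longrightarrow> I = B)"

definition om_rank :: "'a set \<Rightarrow> ('a \<Rightarrow> int) set \<Rightarrow> nat" where
  "om_rank E \<C> = Max (card ` {I. indep E \<C> I})"

definition pos_circuits :: "'a set \<Rightarrow> ('a \<Rightarrow> int) set \<Rightarrow> ('a \<Rightarrow> int) set" where
  "pos_circuits E \<C> = {X \<in> \<C>. \<forall>f\<in>E. X f \<ge> 0}"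

definition e_pos_circuits :: "'a set \<Rightarrow> ('a \<Rightarrow> int) set \<Rightarrow> 'a \<Rightarrow> ('a \<Rightarrow> int) set" where
  "e_pos_circuits E \<C> e = {X \<in> pos_circuits E \<C>. X e = 1}"

definition fund_circuit :: "('a \<Rightarrow> int) set \<Rightarrow> 'a set \<Rightarrow> 'a \<Rightarrow> ('a \<Rightarrow> int)" where
  "fund_circuit \<C> B e = (THE X. X \<in> \<C> \<and> supp X \<subseteq> B \<union> {e} \<and> X e = 1)"

lemma (in oriented_matroid) fund_circuit_ex1:
  assumes B: "basis E \<C> B" and e: "e \<in> E" "e \<notin> B"
  shows "\<exists>!X. X \<in> \<C> \<and> supp X \<subseteq> B \<union> {e} \<and> X e = 1"
proof -
  have indB: "\<forall>X\<in>\<C>. \<not> supp X \<subseteq> B" and BE: "B \<subseteq> E"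
    using B by (auto simp: basis_def indep_def)
  have "\<not> indep E \<C> (B \<union> {e})"
    using B e(2) by (auto simp: basis_def)
  then obtain Y where Y: "Y \<in> \<C>" "supp Y \<subseteq> B \<union> {e}"
    using BE e(1) by (auto simp: indep_def)
  then have "e \<in> supp Y" using indB by blast
  then have "Y e = 1 \<or> opp Y e = 1"
    using signed[OF Y(1)] by (auto simp: signed_set_def supp_def opp_def)
  moreover have "opp Y \<in> \<C>" "supp (opp Y) \<subseteq> B \<union> {e}"
    using symmetric[OF Y(1)] Y(2) by (auto simp: supp_def opp_def)
  ultimately have ex: "\<exists>X. X \<in> \<C> \<and> supp X \<subseteq> B \<union> {e} \<and> X e = 1"
    using Y by blast
  have "X = X'" if X: "X \<in> \<C>" "supp X \<subseteq> B \<union> {e}" "X e = 1"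
    and X': "X' \<in> \<C>" "supp X' \<subseteq> B \<union> {e}" "X' e = 1" for X X'
  proof (rule ccontr)
    assume "X \<noteq> X'"
    then have "X \<noteq> opp (opp X')" by (simp add: opp_def)
    moreover have "e \<in> pos_part X \<inter> neg_part (opp X')"
      using X(3) X'(3) by (simp add: pos_part_def neg_part_def opp_def)
    ultimately obtain Z where Z: "Z \<in> \<C>"
      "pos_part Z \<subseteq> (pos_part X \<union> pos_part (opp X')) - {e}"
      "neg_part Z \<subseteq> (neg_part X \<union> neg_part (opp X')) - {e}"
      using elimination[OF X(1) symmetric[OF X'(1)]] by blast
    have "supp Z = pos_part Z \<union> neg_part Z"
      by (auto simp: supp_def pos_part_def neg_part_def)
    also have "\<dots> \<subseteq> (supp X \<union> supp X') - {e}"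
      using Z(2,3) by (fastforce simp: supp_def pos_part_def neg_part_def opp_def)
    also have "\<dots> \<subseteq> B" using X(2) X'(2) by blast
    finally show False using indB Z(1) by blast
  qed
  with ex show ?thesis by blast
qed

definition e_embracing :: "'a set \<Rightarrow> ('a \<Rightarrow> int) set \<Rightarrow> 'a \<Rightarrow> 'a set \<Rightarrow> bool" where
  "e_embracing E \<C> e B \<longleftrightarrow>
    basis E \<C> B \<and> e \<notin> B \<and> fund_circuit \<C> B e \<in> e_pos_circuits E \<C> e"

text \<open>
  Least length of a walk from \<open>x\<close> to \<open>y\<close> along \<open>R\<close>; it is \<open>\<infinity>\<close> if there is no walk,
  since the infimum of the empty set in \<open>enat\<close> is \<open>\<infinity>\<close>.
\<close>

definition walk_dist :: "('b \<times> 'b) set \<Rightarrow> 'b \<Rightarrow> 'b \<Rightarrow> enat" where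
  "walk_dist R x y = (INF k \<in> {k. (x, y) \<in> R ^^ k}. enat k)"

definition embracing_exchange ::
    "'a set \<Rightarrow> ('a \<Rightarrow> int) set \<Rightarrow> 'a \<Rightarrow> ('a set \<times> 'a set) set" where
  "embracing_exchange E \<C> e =
    {(A, B). e_embracing E \<C> e A \<and> e_embracing E \<C> e B \<and> card ((A - B) \<union> (B - A)) = 2}"

definition embracing_dist ::
    "'a set \<Rightarrow> ('a \<Rightarrow> int) set \<Rightarrow> 'a \<Rightarrow> 'a set \<Rightarrow> 'a set \<Rightarrow> enat" where
  "embracing_dist E \<C> e = walk_dist (embracing_exchange E \<C> e)"

text \<open>
  Adjacency in the 1-skeleton of the oriented matroid polyhedron of the affine oriented
  matroid \<open>(\<M>\<^sup>*, e)\<close>, with vertex set \<open>e_pos_circuits E \<C> e\<close>. The circuit \<open>Z\<close> ranges over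
  all positive circuits, including those with \<open>Z e = 0\<close>.
\<close>

definition skeleton_adj ::
    "'a set \<Rightarrow> ('a \<Rightarrow> int) set \<Rightarrow> 'a \<Rightarrow> (('a \<Rightarrow> int) \<times> ('a \<Rightarrow> int)) set" where
  "skeleton_adj E \<C> e =
    {(X, X'). X \<in> e_pos_circuits E \<C> e \<and> X' \<in> e_pos_circuits E \<C> e \<and> X \<noteq> X' \<and>
      (\<forall>Z\<in>pos_circuits E \<C>. supp Z \<subseteq> supp X \<union> supp X' \<longrightarrow> Z \<in> {X, X'})}"

definition skeleton_dist ::
    "'a set \<Rightarrow> ('a \<Rightarrow> int) set \<Rightarrow> 'a \<Rightarrow> ('a \<Rightarrow> int) \<Rightarrow> ('a \<Rightarrow> int) \<Rightarrow> enat" where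
  "skeleton_dist E \<C> e = walk_dist (skeleton_adj E \<C> e)"

end

theory Submission
  imports Defs
begin

text \<open>
  For an \<open>e\<close>-positive circuit \<open>X\<close>, an \<open>e\<close>-embracing basis with fundamental circuit \<open>X\<close> is the
  same thing as a basis that avoids \<open>e\<close> and contains \<open>supp X - {e}\<close>. The circuit thus cuts the exchange graph of embracing bases
  into fibres, and the theorem compares walks in that graph with their images in the skeleton.

  Inside one fibre the distance is \<open>card (B - B')\<close>: basis exchange never has to remove an element
  of \<open>B \<inter> B'\<close>, so it never leaves the fibre (\<open>walk_within_circuit\<close>), and no exchange lowers
  \<open>card (B - B')\<close> by more than one.

  The lower bound holds because one exchange leaves the circuit unchanged or moves it along an edge
  (\<open>exchange_crosses_edge\<close>). Both circuits lie in the union of two neighbouring bases and \<open>e\<close>, a set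
  of nullity two. For vectors, the linear dependencies on such a set form a plane, the nonnegative
  ones form a cone in it, and a cone in a plane has at most two extreme rays.

  The upper bound needs the converse: if \<open>X\<close> and \<open>X'\<close> are adjacent, then the union \<open>W\<close> of their
  supports has nullity two. Nullity three would leave a circuit in \<open>W - {f, g}\<close> for some
  \<open>f \<in> supp X' - supp X\<close> and \<open>g \<in> supp X - supp X'\<close>; its negative elements can be eliminated
  against \<open>X'\<close> and then against \<open>X\<close>, which yields a third positive circuit in \<open>W\<close>
  (\<open>skeleton_edge_indep\<close>). With nullity two, \<open>W - {e, f}\<close> and \<open>W - {e, g}\<close> are independent sets
  with the same span. A common completion of the two gives neighbouring bases in the fibres of \<open>X\<close>
  and \<open>X'\<close>, and the walks to them inside the two fibres, together with the exchange between them,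
  cost at most \<open>r\<close> exchanges (\<open>exchanges_over_edge\<close>). If all \<open>e\<close>-positive circuits have \<open>r + 1\<close> elements, then each fibre is
  a single basis and an edge costs exactly one exchange.
\<close>

section \<open>Shortest walks\<close>

lemma walk_dist_le: "(x, y) \<in> R ^^ k \<Longrightarrow> walk_dist R x y \<le> enat k"
  unfolding walk_dist_def by (rule INF_lower) simp

lemma walk_dist_attained:
  assumes "walk_dist R x y \<noteq> \<infinity>"
  obtains k where "(x, y) \<in> R ^^ k" "walk_dist R x y = enat k"
proof -
  let ?K = "{k. (x, y) \<in> R ^^ k}"
  have "?K \<noteq> {}"
  proof
    assume "?K = {}"
    then show False using assms unfolding walk_dist_def by (simp add: top_enat_def)
  qed
  then obtain k0 where "k0 \<in> ?K" by blast
  then have "Inf (enat ` ?K) \<in> enat ` ?K" by (intro wellorder_InfI) (rule imageI)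
  then obtain k where k: "k \<in> ?K" "Inf (enat ` ?K) = enat k" by blast
  then show ?thesis using that[of k] by (simp add: walk_dist_def)
qed

lemma walk_dist_le_of_walks:
  assumes "\<And>k. (x, y) \<in> R ^^ k \<Longrightarrow> \<exists>j\<le>c * k. (u, v) \<in> S ^^ j" and "c \<ge> 1"
  shows "walk_dist S u v \<le> enat c * walk_dist R x y"
proof (cases "walk_dist R x y = \<infinity>")
  case True
  then show ?thesis using \<open>c \<ge> 1\<close> by (simp add: enat_0_iff imult_is_infinity)
next
  case False
  then obtain k where k: "(x, y) \<in> R ^^ k" "walk_dist R x y = enat k"
    by (rule walk_dist_attained)
  then obtain j where "j \<le> c * k" "(u, v) \<in> S ^^ j" using assms(1) by blast
  then have "walk_dist S u v \<le> enat (c * k)"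
    by (intro order_trans[OF walk_dist_le]) auto
  then show ?thesis by (simp add: k)
qed

corollary walk_dist_le_of_shorter_walks:
  assumes "\<And>k. (x, y) \<in> R ^^ k \<Longrightarrow> \<exists>j\<le>k. (u, v) \<in> S ^^ j"
  shows "walk_dist S u v \<le> walk_dist R x y"
  using walk_dist_le_of_walks[of x y R 1 u v S] assms
  by (simp add: one_enat_def[symmetric] del: One_nat_def)

section \<open>The underlying matroid\<close>

context oriented_matroid
begin

lemma supp_opp [simp]: "supp (opp X) = supp X"
  and pos_part_opp [simp]: "pos_part (opp X) = neg_part X"
  and neg_part_opp [simp]: "neg_part (opp X) = pos_part X"
  and opp_opp [simp]: "opp (opp X) = X"
  by (auto simp: supp_def opp_def pos_part_def neg_part_def)

lemma supp_parts: "supp X = pos_part X \<union> neg_part X"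
  by (auto simp: supp_def pos_part_def neg_part_def)

lemma supp_subset_ground: "X \<in> \<C> \<Longrightarrow> supp X \<subseteq> E"
  using signed by (force simp: signed_set_def supp_def)

lemma finite_supp [simp]: "X \<in> \<C> \<Longrightarrow> finite (supp X)"
  using supp_subset_ground finite_ground finite_subset by blast

lemma finite_indep: "indep E \<C> I \<Longrightarrow> finite I"
  using finite_ground finite_subset by (auto simp: indep_def)

lemma indep_subset: "indep E \<C> I \<Longrightarrow> J \<subseteq> I \<Longrightarrow> indep E \<C> J"
  unfolding indep_def by blast

text \<open>
  Signed elimination needs opposite signs at \<open>f\<close>; passing to the opposite of a circuit provides
  them and does not change supports.
\<close>

lemma unsigned_elimination:
  assumes "X \<in> \<C>" "Y \<in> \<C>" "supp X \<noteq> supp Y" "f \<in> supp X" "f \<in> supp Y"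
  obtains Z where "Z \<in> \<C>" "supp Z \<subseteq> supp X \<union> supp Y - {f}"
proof -
  have *: "\<exists>Z\<in>\<C>. supp Z \<subseteq> supp X \<union> supp Y - {f}"
    if X: "X \<in> \<C>" and Y: "Y \<in> \<C>" and ne: "supp X \<noteq> supp Y"
      and fX: "f \<in> pos_part X" and fY: "f \<in> supp Y" for X Y
  proof -
    define Y' where "Y' = (if f \<in> neg_part Y then Y else opp Y)"
    have Y': "Y' \<in> \<C>" "supp Y' = supp Y"
      using Y symmetric[OF Y] by (simp_all add: Y'_def)
    have neg: "f \<in> neg_part Y'"
      using fY by (cases "f \<in> neg_part Y") (simp_all add: Y'_def supp_parts)
    then have "X \<noteq> opp Y'" using ne Y'(2) supp_opp by metis
    then obtain Z where "Z \<in> \<C>" "pos_part Z \<subseteq> (pos_part X \<union> pos_part Y') - {f}"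
      "neg_part Z \<subseteq> (neg_part X \<union> neg_part Y') - {f}"
      using elimination[OF X Y'(1)] fX neg by blast
    then have "supp Z \<subseteq> supp X \<union> supp Y' - {f}" unfolding supp_parts by blast
    then show ?thesis using \<open>Z \<in> \<C>\<close> Y'(2) by metis
  qed
  have "f \<in> pos_part X \<or> f \<in> pos_part (opp X)"
    using assms(4) by (auto simp: supp_parts)
  then have "\<exists>Z\<in>\<C>. supp Z \<subseteq> supp X \<union> supp Y - {f}"
    using *[OF assms(1-3) _ assms(5)] *[OF symmetric[OF assms(1)] assms(2) _ _ assms(5)] assms(3)
    unfolding supp_opp by blast
  then show ?thesis using that by blast
qed

text \<open>
  The classical argument: among the independent subsets of \<open>I \<union> J\<close> larger than \<open>I\<close>, take one that
  misses as little of \<open>I\<close> as possible. If it misses some \<open>a\<close>, then adding \<open>a\<close> creates two different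
  circuits through \<open>a\<close>, and eliminating \<open>a\<close> contradicts independence.
\<close>

lemma indep_augment:
  assumes I: "indep E \<C> I" and J: "indep E \<C> J" and less: "card I < card J"
  shows "\<exists>x\<in>J - I. indep E \<C> (insert x I)"
proof (rule ccontr)
  assume maximal: "\<not> ?thesis"
  define P where "P K \<longleftrightarrow> indep E \<C> K \<and> K \<subseteq> I \<union> J \<and> card I < card K" for K
  have "P J" using J less by (auto simp: P_def)
  then obtain K where K: "P K" and K_min: "\<And>L. P L \<Longrightarrow> card (I - K) \<le> card (I - L)"
    using ex_has_least_nat[of P J "\<lambda>K. card (I - K)"] by blast
  have indK: "indep E \<C> K" and KE: "K \<subseteq> E" and finK: "finite K" and finI: "finite I"
    using K I finite_indep by (auto simp: P_def indep_def)
  have "\<not> K \<subseteq> I" using K finI card_mono[of I K] by (auto simp: P_def)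
  then obtain g where g: "g \<in> K - I" by blast
  have "\<not> I \<subseteq> K"
  proof
    assume "I \<subseteq> K"
    then have "indep E \<C> (insert g I)" using indep_subset[OF indK] g by blast
    then show False using maximal g K by (auto simp: P_def)
  qed
  then obtain a where a: "a \<in> I - K" by blast
  \<comment> \<open>Exchanging any element of \<open>K - I\<close> for \<open>a\<close> brings \<open>K\<close> closer to \<open>I\<close>, so it must create a circuit.\<close>
  have ex_circuit: "\<exists>C\<in>\<C>. supp C \<subseteq> insert a (K - {h}) \<and> a \<in> supp C" if h: "h \<in> K - I" for h
  proof -
    let ?T = "insert a (K - {h})"
    have "card ?T = card K"
      using h a finK card_Suc_Diff1[of K h] by auto
    moreover have "card (I - ?T) < card (I - K)"
      using h a finI by (intro psubset_card_mono) auto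
    ultimately have "\<not> indep E \<C> ?T"
      using K_min[of ?T] a K by (fastforce simp: P_def)
    moreover have "?T \<subseteq> E" using KE a I by (auto simp: indep_def)
    ultimately obtain C where C: "C \<in> \<C>" "supp C \<subseteq> ?T" by (auto simp: indep_def)
    moreover have "a \<in> supp C" using C indK by (auto simp: indep_def)
    ultimately show ?thesis by blast
  qed
  obtain C where C: "C \<in> \<C>" "supp C \<subseteq> insert a (K - {g})" "a \<in> supp C"
    using ex_circuit[OF g] by blast
  have "\<not> supp C \<subseteq> I" using I C by (auto simp: indep_def)
  then obtain h where h: "h \<in> supp C" "h \<in> K - I" using C a by auto
  obtain D where D: "D \<in> \<C>" "supp D \<subseteq> insert a (K - {h})" "a \<in> supp D"
    using ex_circuit[OF h(2)] by blast
  have "supp C \<noteq> supp D" using h D a by auto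
  then obtain Z where "Z \<in> \<C>" "supp Z \<subseteq> supp C \<union> supp D - {a}"
    using unsigned_elimination[OF C(1) D(1)] C D by blast
  moreover have "supp C \<union> supp D - {a} \<subseteq> K" using C D by blast
  ultimately show False using indK unfolding indep_def by (meson subset_trans)
qed

lemma basisD: "basis E \<C> B \<Longrightarrow> indep E \<C> B"
  by (simp add: basis_def)

lemma finite_indeps: "finite {I. indep E \<C> I}"
  by (rule finite_subset[of _ "Pow E"]) (use finite_ground in \<open>auto simp: indep_def\<close>)

lemma indep_card_le_rank: "indep E \<C> I \<Longrightarrow> card I \<le> om_rank E \<C>"
  unfolding om_rank_def by (rule Max_ge) (use finite_indeps in auto)

lemma indep_of_rank_card: "\<exists>I. indep E \<C> I \<and> card I = om_rank E \<C>"
proof -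
  have "indep E \<C> {}" using nonempty by (auto simp: indep_def)
  then have "om_rank E \<C> \<in> card ` {I. indep E \<C> I}"
    unfolding om_rank_def by (intro Max_in) (use finite_indeps in auto)
  then show ?thesis by auto
qed

lemma basis_iff_card: "basis E \<C> B \<longleftrightarrow> indep E \<C> B \<and> card B = om_rank E \<C>"
proof
  assume B: "basis E \<C> B"
  obtain I where I: "indep E \<C> I" "card I = om_rank E \<C>" using indep_of_rank_card by blast
  have "\<not> card B < card I"
    using indep_augment[OF basisD[OF B] I(1)] B by (auto simp: basis_def)
  then show "indep E \<C> B \<and> card B = om_rank E \<C>"
    using indep_card_le_rank[OF basisD[OF B]] I basisD[OF B] by auto
next
  assume B: "indep E \<C> B \<and> card B = om_rank E \<C>"
  show "basis E \<C> B"
    unfolding basis_def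
    using B indep_card_le_rank finite_indep by (metis card_seteq)
qed

lemma extend_to_basis:
  assumes "indep E \<C> I" and A: "basis E \<C> A"
  obtains B where "basis E \<C> B" "I \<subseteq> B" "B \<subseteq> I \<union> A"
proof -
  have "\<exists>B. basis E \<C> B \<and> I \<subseteq> B \<and> B \<subseteq> I \<union> A"
    using assms(1)
  proof (induction "om_rank E \<C> - card I" arbitrary: I)
    case 0
    then have "basis E \<C> I" using indep_card_le_rank[of I] by (auto simp: basis_iff_card)
    then show ?case by blast
  next
    case (Suc n)
    have "card I < card A" using Suc(2) A by (simp add: basis_iff_card)
    then obtain x where x: "x \<in> A - I" "indep E \<C> (insert x I)"
      using indep_augment[OF Suc(3) basisD[OF A]] by blast
    then have "n = om_rank E \<C> - card (insert x I)"
      using Suc(2) finite_indep[OF Suc(3)] by simp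
    then obtain B where "basis E \<C> B" "insert x I \<subseteq> B" "B \<subseteq> insert x I \<union> A"
      using Suc(1) x(2) by blast
    then show ?case using x(1) by (intro exI[of _ B]) auto
  qed
  then show ?thesis using that by blast
qed

lemma bases_diff_card_eq:
  assumes "basis E \<C> A" "basis E \<C> B"
  shows "card (A - B) = card (B - A)"
  using assms finite_indep card_le_sym_Diff[of A B] card_le_sym_Diff[of B A]
  by (auto simp: basis_iff_card)

lemma symdiff_card_eq_2_iff:
  assumes "basis E \<C> A" "basis E \<C> B"
  shows "card ((A - B) \<union> (B - A)) = 2 \<longleftrightarrow> card (A - B) = 1"
proof -
  have "card ((A - B) \<union> (B - A)) = card (A - B) + card (B - A)"
    using assms[THEN basisD, THEN finite_indep] by (intro card_Un_disjoint) auto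
  then show ?thesis using bases_diff_card_eq[OF assms] by auto
qed

section \<open>Positive circuits\<close>

lemma pos_circuits_iff: "X \<in> pos_circuits E \<C> \<longleftrightarrow> X \<in> \<C> \<and> neg_part X = {}"
proof -
  have "(\<forall>f\<in>E. X f \<ge> 0) \<longleftrightarrow> neg_part X = {}" if "X \<in> \<C>"
    using signed[OF that] by (force simp: neg_part_def signed_set_def not_less)
  then show ?thesis by (auto simp: pos_circuits_def)
qed

lemma e_pos_circuits_iff:
  "X \<in> e_pos_circuits E \<C> e \<longleftrightarrow> X \<in> pos_circuits E \<C> \<and> e \<in> supp X"
proof -
  have "X e = 1 \<longleftrightarrow> e \<in> supp X" if "X \<in> pos_circuits E \<C>"
  proof -
    have "X e \<in> {-1, 0, 1}" "\<not> X e < 0"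
      using that signed[of X] by (auto simp: signed_set_def pos_circuits_iff neg_part_def)
    then show ?thesis by (auto simp: supp_def)
  qed
  then show ?thesis by (auto simp: e_pos_circuits_def)
qed

lemma pos_circuit_eqI:
  assumes "X \<in> pos_circuits E \<C>" "Y \<in> pos_circuits E \<C>" "supp X \<subseteq> supp Y"
  shows "X = Y"
proof (rule ccontr)
  assume "X \<noteq> Y"
  then have "X = opp Y" using assms incomparable[of X Y] by (auto simp: pos_circuits_iff)
  then have "pos_part X = {}" using assms(2) by (simp add: pos_circuits_iff)
  then have "supp X = {}" using assms(1) by (simp add: pos_circuits_iff supp_parts)
  then show False using assms(1) nonempty by (auto simp: pos_circuits_iff)
qed

text \<open>
  Eliminating against a positive circuit \<open>P\<close> never creates a negative element, so the negative
  elements in \<open>H\<close> can be removed one after the other. The invariant \<open>Q\<close> has to keep the circuit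
  different from \<open>opp P\<close>, the one circuit that cannot be eliminated against \<open>P\<close>.
\<close>

lemma eliminate_negatives:
  assumes P: "P \<in> pos_circuits E \<C>" and H: "H \<subseteq> supp P"
    and not_opp: "\<not> Q (opp P)"
    and step: "\<And>Y Z h. Y \<in> \<C> \<Longrightarrow> Q Y \<Longrightarrow> Z \<in> \<C> \<Longrightarrow> h \<in> H \<Longrightarrow>
        supp Z \<subseteq> supp Y \<union> supp P - {h} \<Longrightarrow> neg_part Z \<subseteq> neg_part Y \<Longrightarrow> Q Z"
    and Y: "Y \<in> \<C>" "Q Y"
  shows "\<exists>Z\<in>\<C>. Q Z \<and> neg_part Z \<subseteq> neg_part Y - H"
  using Y
proof (induction "card (neg_part Y \<inter> H)" arbitrary: Y rule: less_induct)
  case less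
  show ?case
  proof (cases "neg_part Y \<inter> H = {}")
    case True
    then show ?thesis using less.prems by (intro bexI[of _ Y]) auto
  next
    case False
    then obtain h where h: "h \<in> neg_part Y" "h \<in> H" by blast
    have PC: "P \<in> \<C>" and negP: "neg_part P = {}" using P by (auto simp: pos_circuits_iff)
    have "h \<in> pos_part P \<inter> neg_part Y" using h H negP by (auto simp: supp_parts)
    moreover have "P \<noteq> opp Y" using not_opp less.prems(2) opp_opp by metis
    ultimately obtain Z where Z: "Z \<in> \<C>" "pos_part Z \<subseteq> (pos_part P \<union> pos_part Y) - {h}"
      "neg_part Z \<subseteq> (neg_part P \<union> neg_part Y) - {h}"
      using elimination[OF PC less.prems(1)] by blast
    have "supp Z \<subseteq> supp Y \<union> supp P - {h}" using Z(2,3) unfolding supp_parts by blast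
    then have "Q Z" using step[OF less.prems Z(1) h(2)] Z(3) negP by blast
    have "finite (neg_part Y)" using finite_supp[OF less.prems(1)] by (simp add: supp_parts)
    then have "card (neg_part Z \<inter> H) < card (neg_part Y \<inter> H)"
      using Z(3) negP h by (intro psubset_card_mono) auto
    then obtain Z' where "Z' \<in> \<C>" "Q Z'" "neg_part Z' \<subseteq> neg_part Z - H"
      using less.hyps[OF _ Z(1) \<open>Q Z\<close>] by blast
    then show ?thesis using Z(3) negP by blast
  qed
qed

section \<open>Edges of the skeleton have nullity two\<close>

lemma skeleton_adj_sym: "(X, X') \<in> skeleton_adj E \<C> e \<Longrightarrow> (X', X) \<in> skeleton_adj E \<C> e"
  by (auto simp: skeleton_adj_def Un_commute)

lemma skeleton_adjD:
  assumes "(X, X') \<in> skeleton_adj E \<C> e"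
  shows "X \<in> e_pos_circuits E \<C> e" "X' \<in> e_pos_circuits E \<C> e"
    "X \<in> pos_circuits E \<C>" "X' \<in> pos_circuits E \<C>" "X \<in> \<C>" "X' \<in> \<C>"
    "e \<in> supp X" "e \<in> supp X'" "\<not> supp X \<subseteq> supp X'" "\<not> supp X' \<subseteq> supp X"
  using assms pos_circuit_eqI[of X X'] pos_circuit_eqI[of X' X]
  by (auto simp: skeleton_adj_def e_pos_circuits_iff pos_circuits_iff)

text \<open>
  This says that the union of the supports has nullity two: a circuit in the complement of
  \<open>{f, g}\<close> would lead to a third positive circuit. First the negative elements outside \<open>X\<close> are
  eliminated against \<open>X'\<close>, then those in \<open>X\<close> against \<open>X\<close>. The order matters. During the first
  phase the circuit avoids \<open>g\<close> and misses part of \<open>supp X' - supp X\<close>. The second phase may bring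
  \<open>g\<close> back, but the circuit keeps missing part of \<open>supp X' - supp X\<close> and stays outside \<open>supp X\<close>,
  and this tells it apart from \<open>X'\<close> and from \<open>X\<close>.
\<close>

lemma skeleton_edge_indep:
  assumes adj: "(X, X') \<in> skeleton_adj E \<C> e"
    and f: "f \<in> supp X' - supp X" and g: "g \<in> supp X - supp X'"
  shows "indep E \<C> (supp X \<union> supp X' - {f, g})"
proof (rule ccontr)
  let ?W = "supp X \<union> supp X'"
  note X = skeleton_adjD[OF adj]
  assume "\<not> ?thesis"
  moreover have "?W \<subseteq> E" using X supp_subset_ground by blast
  ultimately obtain Y where Y: "Y \<in> \<C>" "supp Y \<subseteq> ?W - {f, g}"
    unfolding indep_def by blast
  \<comment> \<open>\<open>Q1\<close> does not demand that \<open>f\<close> itself be avoided: an elimination may restore \<open>f\<close>, but it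
    removes another element of \<open>supp X' - supp X\<close>.\<close>
  define Q1 where "Q1 Y \<longleftrightarrow> supp Y \<subseteq> ?W - {g} \<and> \<not> supp X' - supp X \<subseteq> supp Y" for Y :: "'a \<Rightarrow> int"
  have "\<exists>Z\<in>\<C>. Q1 Z \<and> neg_part Z \<subseteq> neg_part Y - (supp X' - supp X)"
  proof (rule eliminate_negatives[OF X(4)])
    show "\<not> Q1 (opp X')" by (simp add: Q1_def)
    show "Q1 Y" using Y f by (auto simp: Q1_def)
  qed (use Y g in \<open>auto simp: Q1_def\<close>)
  then obtain Y1 where Y1: "Y1 \<in> \<C>" "Q1 Y1" "neg_part Y1 \<subseteq> neg_part Y - (supp X' - supp X)"
    by blast
  have "neg_part Y1 \<subseteq> supp Y1" unfolding supp_parts by blast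
  then have neg_Y1: "neg_part Y1 \<subseteq> supp X" using Y1(2,3) by (auto simp: Q1_def)
  have not_sub: "\<not> supp Z \<subseteq> supp X" if "Z \<in> \<C>" "h \<in> supp X" "h \<notin> supp Z" for Z h
    using incomparable[OF that(1) X(5)] that by auto
  define Q2 where "Q2 Y \<longleftrightarrow> supp Y \<subseteq> ?W \<and> \<not> supp X' - supp X \<subseteq> supp Y \<and> \<not> supp Y \<subseteq> supp X"
    for Y :: "'a \<Rightarrow> int"
  have "\<exists>Z\<in>\<C>. Q2 Z \<and> neg_part Z \<subseteq> neg_part Y1 - supp X"
  proof (rule eliminate_negatives[OF X(3)])
    show "\<not> Q2 (opp X)" by (simp add: Q2_def)
    show "Q2 Y1" using Y1 not_sub[OF Y1(1), of g] g by (auto simp: Q1_def Q2_def)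
    show "Q2 Z" if "Y \<in> \<C>" "Q2 Y" "Z \<in> \<C>" "h \<in> supp X" "supp Z \<subseteq> supp Y \<union> supp X - {h}"
      for Y Z h
      using that not_sub[OF that(3,4)] unfolding Q2_def by blast
  qed (use Y1 in auto)
  then obtain Z where Z: "Z \<in> \<C>" "Q2 Z" "neg_part Z \<subseteq> neg_part Y1 - supp X" by blast
  then have "Z \<in> pos_circuits E \<C>" using neg_Y1 by (auto simp: pos_circuits_iff)
  then have "Z \<in> {X, X'}" using adj Z(2) by (auto simp: skeleton_adj_def Q2_def)
  then show False using Z(2) by (auto simp: Q2_def)
qed

text \<open>
  In nullity two the element \<open>g\<close> can be replaced by \<open>e\<close>: eliminating \<open>g\<close> between \<open>X\<close> and a circuit
  that avoids \<open>e\<close> and \<open>f\<close> gives a circuit that avoids \<open>f\<close> and \<open>g\<close>.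
\<close>

lemma skeleton_edge_indep':
  assumes adj: "(X, X') \<in> skeleton_adj E \<C> e" and f: "f \<in> supp X' - supp X"
  shows "indep E \<C> (supp X \<union> supp X' - {e, f})"
proof (rule ccontr)
  let ?W = "supp X \<union> supp X'"
  note X = skeleton_adjD[OF adj]
  obtain g where g: "g \<in> supp X - supp X'" using X by blast
  have indep: "\<not> supp Z \<subseteq> ?W - {f, g}" if "Z \<in> \<C>" for Z
    using skeleton_edge_indep[OF adj f g] that by (simp add: indep_def)
  assume "\<not> ?thesis"
  moreover have "?W \<subseteq> E" using X supp_subset_ground by blast
  ultimately obtain Y where Y: "Y \<in> \<C>" "supp Y \<subseteq> ?W - {e, f}"
    unfolding indep_def by blast
  have "g \<in> supp Y" using indep[OF Y(1)] Y(2) by blast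
  moreover have "supp X \<noteq> supp Y" using X Y by blast
  ultimately obtain Z where "Z \<in> \<C>" "supp Z \<subseteq> supp X \<union> supp Y - {g}"
    using unsigned_elimination[OF X(5) Y(1)] g by blast
  then show False using indep[of Z] Y(2) f by blast
qed

section \<open>Embracing bases\<close>

text \<open>
  The fibre over \<open>X\<close> of the map from embracing bases to their fundamental circuits.
\<close>

definition embraces_via :: "'a \<Rightarrow> ('a \<Rightarrow> int) \<Rightarrow> 'a set \<Rightarrow> bool" where
  "embraces_via e X B \<longleftrightarrow>
    basis E \<C> B \<and> e \<notin> B \<and> X \<in> e_pos_circuits E \<C> e \<and> supp X \<subseteq> insert e B"

text \<open>
  The uniqueness of fundamental circuits makes \<open>embraces_via\<close> the relational form of
  \<open>fund_circuit\<close>, with no definite description left.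
\<close>

lemma embraces_via_iff:
  assumes "e \<in> E"
  shows "embraces_via e X B \<longleftrightarrow> e_embracing E \<C> e B \<and> fund_circuit \<C> B e = X"
proof (cases "basis E \<C> B \<and> e \<notin> B")
  case True
  let ?F = "\<lambda>X. X \<in> \<C> \<and> supp X \<subseteq> B \<union> {e} \<and> X e = 1"
  have ex1: "\<exists>!X. ?F X" using fund_circuit_ex1 True assms by blast
  have F: "?F (fund_circuit \<C> B e)" unfolding fund_circuit_def by (rule theI'[OF ex1])
  show ?thesis
  proof
    assume "embraces_via e X B"
    then have "X \<in> e_pos_circuits E \<C> e" "?F X"
      by (auto simp: embraces_via_def e_pos_circuits_def pos_circuits_def)
    moreover from this have "fund_circuit \<C> B e = X" using F ex1 by blast
    ultimately show "e_embracing E \<C> e B \<and> fund_circuit \<C> B e = X"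
      using True by (simp add: e_embracing_def)
  next
    assume "e_embracing E \<C> e B \<and> fund_circuit \<C> B e = X"
    then show "embraces_via e X B"
      using True F by (auto simp: e_embracing_def embraces_via_def)
  qed
next
  case False
  then show ?thesis by (auto simp: embraces_via_def e_embracing_def)
qed

lemma embraces_via_unique:
  assumes "embraces_via e X B" and Z: "Z \<in> pos_circuits E \<C>" "supp Z \<subseteq> insert e B"
  shows "Z = X"
proof -
  have B: "basis E \<C> B" "e \<notin> B" and X: "X \<in> e_pos_circuits E \<C> e" "supp X \<subseteq> insert e B"
    using assms(1) by (auto simp: embraces_via_def)
  have "X \<in> \<C>" "e \<in> supp X" using X by (auto simp: e_pos_circuits_iff pos_circuits_iff)
  then have "e \<in> E" using supp_subset_ground by blast
  have "\<not> supp Z \<subseteq> B" using Z basisD[OF B(1)] by (auto simp: indep_def pos_circuits_iff)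
  then have "Z \<in> e_pos_circuits E \<C> e" using Z by (auto simp: e_pos_circuits_iff)
  then have "embraces_via e Z B" using B Z(2) by (simp add: embraces_via_def)
  then show ?thesis using assms(1) embraces_via_iff[OF \<open>e \<in> E\<close>] by auto
qed

text \<open>
  Deleting \<open>e\<close> from a circuit leaves an independent set, and no basis that contains the rest can
  contain \<open>e\<close>. The intermediate vertices of a skeleton walk are lifted to bases in this way.
\<close>

lemma embraces_via_exists:
  assumes X: "X \<in> e_pos_circuits E \<C> e"
  obtains B where "embraces_via e X B"
proof -
  have C: "X \<in> \<C>" "e \<in> supp X" using X by (auto simp: e_pos_circuits_iff pos_circuits_iff)
  have "indep E \<C> (supp X - {e})"
    using incomparable[OF _ C(1)] C supp_subset_ground[OF C(1)]
    by (fastforce simp: indep_def)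
  moreover obtain A where "basis E \<C> A" using indep_of_rank_card basis_iff_card by blast
  ultimately obtain B where B: "basis E \<C> B" "supp X - {e} \<subseteq> B" by (rule extend_to_basis)
  moreover have "e \<notin> B"
  proof
    assume "e \<in> B"
    then have "supp X \<subseteq> B" using B(2) by blast
    then show False using basisD[OF B(1)] C(1) by (auto simp: indep_def)
  qed
  ultimately show ?thesis using that X by (auto simp: embraces_via_def)
qed

lemma embracing_exchangeI:
  assumes "e \<in> E" "embraces_via e X A" "embraces_via e X' B" "card (A - B) = 1"
  shows "(A, B) \<in> embracing_exchange E \<C> e"
proof -
  have emb: "e_embracing E \<C> e A" "e_embracing E \<C> e B"
    using assms(2,3) embraces_via_iff[OF assms(1)] by blast+
  then have "card ((A - B) \<union> (B - A)) = 2"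
    using symdiff_card_eq_2_iff[of A B] assms(4) by (simp add: e_embracing_def)
  then show ?thesis using emb by (simp add: embracing_exchange_def)
qed

lemma embracing_exchangeE:
  assumes "e \<in> E" "(A, B) \<in> embracing_exchange E \<C> e"
  obtains X X' where "embraces_via e X A" "embraces_via e X' B" "card (A - B) = 1"
proof -
  have emb: "e_embracing E \<C> e A" "e_embracing E \<C> e B"
    and card: "card ((A - B) \<union> (B - A)) = 2"
    using assms(2) by (auto simp: embracing_exchange_def)
  have "card (A - B) = 1"
    using symdiff_card_eq_2_iff[of A B] emb card by (simp add: e_embracing_def)
  then show ?thesis using that emb embraces_via_iff[OF assms(1)] by blast
qed

text \<open>
  The fibre over \<open>X\<close> is closed under exchanges that keep \<open>A \<inter> B\<close> and only introduce elements of
  \<open>B\<close>, because \<open>supp X - {e} \<subseteq> A \<inter> B\<close> and \<open>e \<notin> A \<union> B\<close>.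
\<close>

lemma walk_within_circuit:
  assumes e: "e \<in> E" and A: "embraces_via e X A" and B: "embraces_via e X B"
  shows "(A, B) \<in> embracing_exchange E \<C> e ^^ card (A - B)"
  using A
proof (induction "card (A - B)" arbitrary: A)
  case 0
  have bases: "basis E \<C> A" "basis E \<C> B" using 0(2) B by (auto simp: embraces_via_def)
  have "A \<subseteq> B" using 0(1) finite_indep[OF basisD[OF bases(1)]] by auto
  then have "A = B" using bases by (auto simp: basis_def)
  then show ?case by simp
next
  case (Suc n)
  have bases: "basis E \<C> A" "basis E \<C> B" using Suc(3) B by (auto simp: embraces_via_def)
  have fin: "finite A" "finite B" using bases finite_indep basisD by auto
  have card_BA: "card (B - A) = Suc n" using bases_diff_card_eq[OF bases] Suc(2) by simp
  then obtain y where y: "y \<in> B - A" by (metis card.empty ex_in_conv nat.simps(3))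
  have "indep E \<C> (insert y (A \<inter> B))"
    by (rule indep_subset[OF basisD[OF bases(2)]]) (use y in auto)
  then obtain A1 where A1: "basis E \<C> A1" "insert y (A \<inter> B) \<subseteq> A1" "A1 \<subseteq> insert y (A \<inter> B) \<union> A"
    using bases(1) by (rule extend_to_basis)
  have "embraces_via e X A1"
    using A1 y Suc(3) B unfolding embraces_via_def by blast
  have "A1 - A = {y}" using A1 y by blast
  then have "card (A - A1) = 1" using bases_diff_card_eq[OF bases(1) A1(1)] by simp
  then have step: "(A, A1) \<in> embracing_exchange E \<C> e"
    using embracing_exchangeI[OF e Suc(3) \<open>embraces_via e X A1\<close>] by blast
  have "B - A1 = (B - A) - {y}" using A1 y by blast
  then have "card (A1 - B) = n"
    using bases_diff_card_eq[OF bases(2) A1(1)] card_BA y fin by simp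
  then have "(A1, B) \<in> embracing_exchange E \<C> e ^^ n"
    using Suc(1)[OF _ \<open>embraces_via e X A1\<close>] by simp
  then show ?case unfolding Suc(2)[symmetric] using relpow_Suc_I2[OF step] by blast
qed

lemma card_diff_le_walk_length:
  assumes "e \<in> E" "finite A" "(A, B) \<in> embracing_exchange E \<C> e ^^ k"
  shows "card (A - B) \<le> k"
  using assms(3)
proof (induction k arbitrary: B)
  case 0
  then show ?case by simp
next
  case (Suc k)
  then obtain D where D: "(A, D) \<in> embracing_exchange E \<C> e ^^ k"
    "(D, B) \<in> embracing_exchange E \<C> e" by auto
  have DB: "card (D - B) = 1" using embracing_exchangeE[OF assms(1) D(2)] by blast
  then have "finite (D - B)" by (simp add: card_ge_0_finite)
  then have "card (A - B) \<le> card ((A - D) \<union> (D - B))"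
    using \<open>finite A\<close> by (intro card_mono) auto
  then show ?case using DB Suc.IH[OF D(1)] card_Un_le[of "A - D" "D - B"] by linarith
qed

section \<open>From exchanges to skeleton walks\<close>

text \<open>
  Write \<open>A - B = {g}\<close> and \<open>B - A = {f}\<close>. A third positive circuit \<open>Z\<close> would contain \<open>g\<close>, since \<open>X'\<close>
  is the only positive circuit in \<open>insert e B\<close>. Eliminating \<open>g\<close> between \<open>X\<close> and \<open>opp Z\<close> leaves a
  circuit in \<open>insert e B\<close>, hence \<open>X'\<close> or its opposite; the sign at \<open>f\<close> decides for \<open>opp X'\<close>, whose
  negative elements come from \<open>Z\<close>. So \<open>supp X' \<subseteq> supp Z\<close>, and \<open>Z\<close> is \<open>X'\<close> after all.
\<close>

lemma exchange_crosses_edge: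
  assumes e: "e \<in> E" and A: "embraces_via e X A" and B: "embraces_via e X' B"
    and exch: "card (A - B) = 1" and ne: "X \<noteq> X'"
  shows "(X, X') \<in> skeleton_adj E \<C> e"
proof -
  have bases: "basis E \<C> A" "basis E \<C> B" and eAB: "e \<notin> A" "e \<notin> B"
    and X: "X \<in> e_pos_circuits E \<C> e" "supp X \<subseteq> insert e A"
    and X': "X' \<in> e_pos_circuits E \<C> e" "supp X' \<subseteq> insert e B"
    using A B by (auto simp: embraces_via_def)
  have C: "X \<in> \<C>" "X' \<in> \<C>" "neg_part X = {}" "neg_part X' = {}"
    "X \<in> pos_circuits E \<C>" "X' \<in> pos_circuits E \<C>"
    using X X' by (auto simp: e_pos_circuits_iff pos_circuits_iff)
  obtain g where "A - B = {g}" using exch by (meson card_1_singletonE)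
  then have g: "g \<notin> B" "A \<subseteq> insert g B" by auto
  obtain f where "B - A = {f}"
    using exch bases_diff_card_eq[OF bases] by (metis card_1_singletonE)
  then have f: "f \<in> B" "f \<notin> A" "B \<subseteq> insert f A" by auto
  have f_notin: "f \<notin> supp X" using f(1,2) X(2) eAB(2) by blast
  have "Z = X \<or> Z = X'" if Z: "Z \<in> pos_circuits E \<C>" "supp Z \<subseteq> supp X \<union> supp X'" for Z
  proof (rule ccontr)
    assume neq: "\<not> ?thesis"
    have ZC: "Z \<in> \<C>" "neg_part Z = {}" using Z by (auto simp: pos_circuits_iff)
    have "\<not> supp Z \<subseteq> insert e B" using embraces_via_unique[OF B Z(1)] neq by blast
    then have gZ: "g \<in> supp Z" using Z(2) X(2) X'(2) g(2) by blast
    have "\<not> supp X \<subseteq> insert e B" using embraces_via_unique[OF B C(5)] ne by blast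
    then have gX: "g \<in> supp X" using X(2) g(2) by blast
    have "g \<in> pos_part X \<inter> neg_part (opp Z)"
      using gX gZ C(3) ZC(2) by (simp add: supp_parts)
    moreover have "X \<noteq> opp (opp Z)" using neq by auto
    ultimately obtain Y where Y: "Y \<in> \<C>"
      "pos_part Y \<subseteq> (pos_part X \<union> pos_part (opp Z)) - {g}"
      "neg_part Y \<subseteq> (neg_part X \<union> neg_part (opp Z)) - {g}"
      using elimination[OF C(1) symmetric[OF ZC(1)]] by blast
    have pos_Y: "pos_part Y \<subseteq> supp X - {g}" and neg_Y: "neg_part Y \<subseteq> supp Z - {g}"
      using Y(2,3) C(3) ZC(2) by (auto simp: supp_parts)
    have supp_Y: "supp Y \<subseteq> insert e B"
      using pos_Y neg_Y Z(2) X(2) X'(2) g(2) unfolding supp_parts[of Y] by blast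
    have "\<not> supp X' \<subseteq> insert e A" using embraces_via_unique[OF A C(6)] ne by blast
    then have f': "f \<in> supp X'" using X'(2) f(3) by blast
    have "supp Y = supp X'"
    proof (rule ccontr)
      assume neqY: "supp Y \<noteq> supp X'"
      have "\<not> supp Y \<subseteq> B" using basisD[OF bases(2)] Y(1) by (simp add: indep_def)
      then have "e \<in> supp Y" using supp_Y by blast
      moreover have "e \<in> supp X'" using X' by (simp add: e_pos_circuits_iff)
      ultimately obtain V where "V \<in> \<C>" "supp V \<subseteq> supp Y \<union> supp X' - {e}"
        using unsigned_elimination[OF Y(1) C(2) neqY] by blast
      moreover have "supp Y \<union> supp X' - {e} \<subseteq> B" using supp_Y X'(2) by blast
      ultimately show False
        using basisD[OF bases(2)] unfolding indep_def by (meson subset_trans)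
    qed
    then have "Y = X' \<or> Y = opp X'" using incomparable[OF Y(1) C(2)] by simp
    \<comment> \<open>\<open>Y = X'\<close> is excluded by \<open>f\<close>, which lies in \<open>X'\<close> but not in \<open>X\<close>.\<close>
    moreover have "Y \<noteq> X'" using pos_Y C(4) f' f_notin by (auto simp: supp_parts)
    ultimately have "Y = opp X'" by blast
    then have "supp X' \<subseteq> supp Z" using neg_Y C(4) by (auto simp: supp_parts)
    then show False using pos_circuit_eqI[OF C(6) Z(1)] neq by blast
  qed
  then show ?thesis using X(1) X'(1) ne by (auto simp: skeleton_adj_def)
qed

lemma skeleton_walk_of_exchanges:
  assumes e: "e \<in> E" and A: "embraces_via e X A"
    and "embraces_via e X' B" "(A, B) \<in> embracing_exchange E \<C> e ^^ k"
  shows "\<exists>j\<le>k. (X, X') \<in> skeleton_adj E \<C> e ^^ j"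
  using assms(3,4)
proof (induction k arbitrary: X' B)
  case 0
  then have "X = X'" using A embraces_via_iff[OF e] by auto
  then show ?case by simp
next
  case (Suc k)
  then obtain D where D: "(A, D) \<in> embracing_exchange E \<C> e ^^ k"
    "(D, B) \<in> embracing_exchange E \<C> e" by auto
  obtain V where V: "embraces_via e V D" and card: "card (D - B) = 1"
    using embracing_exchangeE[OF e D(2)] by blast
  obtain j where j: "j \<le> k" "(X, V) \<in> skeleton_adj E \<C> e ^^ j" using Suc.IH[OF V D(1)] by blast
  show ?case
  proof (cases "V = X'")
    case True
    then show ?thesis using j by (auto intro: le_SucI)
  next
    case False
    then have "(V, X') \<in> skeleton_adj E \<C> e"
      using exchange_crosses_edge[OF e V Suc.prems(1) card] by blast
    then have "(X, X') \<in> skeleton_adj E \<C> e ^^ Suc j" using j(2) by auto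
    then show ?thesis using j(1) by (meson Suc_le_mono)
  qed
qed

section \<open>From skeleton walks to exchanges\<close>

lemma card_skeleton_edge:
  assumes adj: "(X, X') \<in> skeleton_adj E \<C> e" and f: "f \<in> supp X' - supp X"
  shows "card (supp X \<union> supp X' - {e, f}) + 2 = card (supp X \<union> supp X')"
proof -
  note X = skeleton_adjD[OF adj]
  have sub: "{e, f} \<subseteq> supp X \<union> supp X'" and "e \<noteq> f" and fin: "finite (supp X \<union> supp X')"
    using X(5-8) f by auto
  then show ?thesis using card_Diff_subset[of "{e, f}"] card_mono[OF fin sub] by simp
qed

text \<open>
  The walk goes from \<open>A\<close> to a basis \<open>A1\<close> in the same fibre, crosses to \<open>A2\<close> over \<open>X'\<close>, and continues
  to \<open>B\<close>. The set \<open>A1\<close> contains \<open>I = W - {e, f}\<close> and takes all other elements from \<open>A\<close>. Let \<open>a\<close>,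
  \<open>b\<close>, \<open>c\<close> be the sizes of \<open>supp X' - supp X\<close>, \<open>supp X - supp X'\<close> and \<open>supp X \<inter> supp X'\<close>. The three
  parts of the walk cost at most \<open>a - 1\<close>, \<open>1\<close> and \<open>b - 1 + card (A1 - I)\<close>, and
  \<open>card (A1 - I) = r - (a + b + c - 2)\<close>. The sum is \<open>r + 1 - c\<close>, where \<open>c \<ge> 1\<close> because of \<open>e\<close>.
\<close>

lemma exchanges_over_edge:
  assumes e: "e \<in> E" and adj: "(X, X') \<in> skeleton_adj E \<C> e"
    and A: "embraces_via e X A" and B: "embraces_via e X' B"
  shows "\<exists>k\<le>om_rank E \<C>. (A, B) \<in> embracing_exchange E \<C> e ^^ k"
proof -
  note X = skeleton_adjD[OF adj]
  let ?W = "supp X \<union> supp X'" and ?r = "om_rank E \<C>"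
  obtain f where f: "f \<in> supp X' - supp X" using X(10) by blast
  obtain g where g: "g \<in> supp X - supp X'" using X(9) by blast
  define I where "I = ?W - {e, f}"
  have I: "indep E \<C> I" unfolding I_def by (rule skeleton_edge_indep'[OF adj f])
  have I': "indep E \<C> (?W - {e, g})"
    using skeleton_edge_indep'[OF skeleton_adj_sym[OF adj] g] by (simp add: Un_commute)
  have A': "basis E \<C> A" "e \<notin> A" "supp X \<subseteq> insert e A"
    and B': "basis E \<C> B" "e \<notin> B" "supp X' \<subseteq> insert e B"
    using A B by (auto simp: embraces_via_def)
  obtain A1 where A1: "basis E \<C> A1" "I \<subseteq> A1" "A1 \<subseteq> I \<union> A"
    using extend_to_basis[OF I A'(1)] .
  have e_A1: "e \<notin> A1" using A1(3) A'(2) by (auto simp: I_def)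
  have "supp X \<noteq> supp X'" using f by blast
  then obtain D where D: "D \<in> \<C>" "supp D \<subseteq> ?W - {e}"
    using unsigned_elimination[OF X(5,6) _ X(7,8)] by blast
  \<comment> \<open>The circuit \<open>D\<close> contains both \<open>f\<close> and \<open>g\<close>, so replacing \<open>g\<close> by \<open>f\<close> in \<open>A1\<close> keeps the span.\<close>
  have "\<not> supp D \<subseteq> I" "\<not> supp D \<subseteq> ?W - {e, g}" "\<not> supp D \<subseteq> A1"
    using I I' basisD[OF A1(1)] D(1) by (auto simp: indep_def)
  then have fD: "f \<in> supp D" and gD: "g \<in> supp D" and f_A1: "f \<notin> A1"
    using D(2) A1(2) unfolding I_def by blast+
  have g_A1: "g \<in> A1" using A1(2) f g X(8) unfolding I_def by blast
  define A2 where "A2 = insert f (A1 - {g})"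
  have A2: "basis E \<C> A2"
  proof -
    have "\<not> supp C \<subseteq> A2" if C: "C \<in> \<C>" for C
    proof
      assume sub: "supp C \<subseteq> A2"
      have ind: "\<not> supp Z \<subseteq> A1" if "Z \<in> \<C>" for Z
        using basisD[OF A1(1)] that by (auto simp: indep_def)
      have "f \<in> supp C" using ind[OF C] sub by (auto simp: A2_def)
      moreover have "supp C \<noteq> supp D" using gD sub f g by (auto simp: A2_def)
      ultimately obtain Z where Z: "Z \<in> \<C>" "supp Z \<subseteq> supp C \<union> supp D - {f}"
        using unsigned_elimination[OF C D(1)] fD by blast
      have "supp C - {f} \<subseteq> A1" "supp D - {f} \<subseteq> A1"
        using sub D(2) A1(2) unfolding A2_def I_def by blast+
      then show False using ind[OF Z(1)] Z(2) by blast
    qed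
    moreover have "A2 \<subseteq> E"
      using basisD[OF A1(1)] X(6) f supp_subset_ground[of X'] by (auto simp: A2_def indep_def)
    moreover have "card A2 = card A1"
      using f_A1 g_A1 finite_indep[OF basisD[OF A1(1)]] card_Suc_Diff1[of A1 g]
      by (simp add: A2_def)
    ultimately show ?thesis using A1(1) by (simp add: basis_iff_card indep_def)
  qed
  have emb1: "embraces_via e X A1"
    using A1(1,2) e_A1 X(1) f unfolding embraces_via_def I_def by blast
  have emb2: "embraces_via e X' A2"
    using A2 A1(2) e_A1 X(2,7) f g unfolding embraces_via_def I_def A2_def by blast
  have "A1 - A2 = {g}" using f_A1 g_A1 f g by (auto simp: A2_def)
  then have "(A1, A2) \<in> embracing_exchange E \<C> e"
    using embracing_exchangeI[OF e emb1 emb2] by simp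
  then have "(A, A2) \<in> embracing_exchange E \<C> e ^^ Suc (card (A - A1))"
    using walk_within_circuit[OF e A emb1] by auto
  then have walk: "(A, B) \<in> embracing_exchange E \<C> e ^^ (Suc (card (A - A1)) + card (A2 - B))"
    using walk_within_circuit[OF e emb2 B] unfolding relpow_add by (rule relcompI)
  define a where "a = card (supp X' - supp X)"
  define b where "b = card (supp X - supp X')"
  define c where "c = card (supp X \<inter> supp X')"
  have fin: "finite (supp X)" "finite (supp X')" using X(5,6) by simp_all
  have "A1 - A \<subseteq> supp X' - supp X - {f}"
    using A1(3) A'(3) unfolding I_def by blast
  then have "card (A1 - A) \<le> card (supp X' - supp X - {f})" using fin by (intro card_mono) auto
  then have "card (A - A1) < a"
    using bases_diff_card_eq[OF A'(1) A1(1)] f fin card_Suc_Diff1[of "supp X' - supp X" f]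
    by (simp add: a_def)
  moreover have "card (A2 - B) < b + card (A1 - I)"
  proof -
    have "A2 - B \<subseteq> (supp X - supp X' - {g}) \<union> (A1 - I)"
      using B'(3) f X(7) unfolding A2_def I_def by blast
    then have "card (A2 - B) \<le> card ((supp X - supp X' - {g}) \<union> (A1 - I))"
      using fin finite_indep[OF basisD[OF A1(1)]] by (intro card_mono) auto
    also have "\<dots> \<le> card (supp X - supp X' - {g}) + card (A1 - I)" by (rule card_Un_le)
    finally show ?thesis
      using g fin card_Suc_Diff1[of "supp X - supp X'" g] by (simp add: b_def)
  qed
  moreover have "card (A1 - I) + card I = ?r"
    using A1(1,2) finite_indep[OF I] finite_indep[OF basisD[OF A1(1)]] card_mono[of A1 I]
    by (simp add: card_Diff_subset basis_iff_card)
  moreover have "card I + 2 = a + b + c"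
  proof -
    have "card ?W = card (supp X' - supp X) + card (supp X)"
      using fin card_Un_disjoint[of "supp X' - supp X" "supp X"] by (simp add: Un_commute Int_commute)
    also have "card (supp X) = card (supp X \<inter> supp X') + card (supp X - supp X')"
      using fin card_Int_Diff[of "supp X" "supp X'"] by simp
    finally show ?thesis using card_skeleton_edge[OF adj f] by (simp add: a_def b_def c_def I_def)
  qed
  moreover have "c \<ge> 1"
  proof -
    have "supp X \<inter> supp X' \<noteq> {}" using X(7,8) by blast
    then show ?thesis using fin by (simp add: c_def Suc_le_eq card_gt_0_iff)
  qed
  ultimately have "Suc (card (A - A1)) + card (A2 - B) \<le> ?r" by linarith
  then show ?thesis using walk by blast
qed

text \<open>
  The walk has to be nonempty: two bases in the fibre of the same circuit are joined by an empty
  skeleton walk, but need not be equal.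
\<close>

lemma exchanges_over_skeleton_walk:
  assumes e: "e \<in> E" and A: "embraces_via e X A"
    and "embraces_via e X' B" "(X, X') \<in> skeleton_adj E \<C> e ^^ Suc n"
  shows "\<exists>k\<le>om_rank E \<C> * Suc n. (A, B) \<in> embracing_exchange E \<C> e ^^ k"
  using assms(3,4)
proof (induction n arbitrary: X' B)
  case 0
  then show ?case using exchanges_over_edge[OF e _ A] by simp
next
  case (Suc n)
  then obtain V where V: "(X, V) \<in> skeleton_adj E \<C> e ^^ Suc n" "(V, X') \<in> skeleton_adj E \<C> e"
    by (metis relpow_Suc_E)
  then obtain D where D: "embraces_via e V D" using skeleton_adjD(1) embraces_via_exists by metis
  obtain k where k: "k \<le> om_rank E \<C> * Suc n" "(A, D) \<in> embracing_exchange E \<C> e ^^ k"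
    using Suc.IH[OF D V(1)] by blast
  obtain l where l: "l \<le> om_rank E \<C>" "(D, B) \<in> embracing_exchange E \<C> e ^^ l"
    using exchanges_over_edge[OF e V(2) D Suc.prems(1)] by blast
  have "(A, B) \<in> embracing_exchange E \<C> e ^^ (k + l)" using k l by (auto simp: relpow_add)
  moreover have "k + l \<le> om_rank E \<C> * Suc (Suc n)" using k l by simp
  ultimately show ?case by blast
qed

text \<open>
  A circuit with \<open>r + 1\<close> elements fills \<open>insert e A\<close>, so \<open>A\<close> is determined by \<open>X\<close>. The union \<open>W\<close> has
  nullity two, hence at most \<open>r + 2\<close> elements, and the two supports differ in one element each.
\<close>

lemma uniform_edge_is_exchange:
  assumes e: "e \<in> E" and adj: "(X, X') \<in> skeleton_adj E \<C> e"
    and uniform: "\<forall>X\<in>e_pos_circuits E \<C> e. card (supp X) = om_rank E \<C> + 1"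
    and A: "embraces_via e X A" and B: "embraces_via e X' B"
  shows "(A, B) \<in> embracing_exchange E \<C> e"
proof -
  note X = skeleton_adjD[OF adj]
  have full: "A = supp X - {e}" if "embraces_via e X A" for X A
  proof -
    have A: "basis E \<C> A" "e \<notin> A" "X \<in> e_pos_circuits E \<C> e" "supp X \<subseteq> insert e A"
      using that by (auto simp: embraces_via_def)
    then have "supp X = insert e A"
      using uniform finite_indep[OF basisD[OF A(1)]]
      by (intro card_subset_eq) (auto simp: basis_iff_card)
    then show ?thesis using A(2) by auto
  qed
  obtain f where f: "f \<in> supp X' - supp X" using X(10) by blast
  have "card (supp X \<union> supp X' - {e, f}) \<le> om_rank E \<C>"
    by (rule indep_card_le_rank[OF skeleton_edge_indep'[OF adj f]])
  moreover have "card (supp X \<union> supp X') = card (supp X - supp X') + card (supp X')"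
    using X(5,6) card_Un_disjoint[of "supp X - supp X'" "supp X'"] by (simp add: Int_commute)
  ultimately have "card (supp X - supp X') \<le> 1"
    using card_skeleton_edge[OF adj f] uniform X(2) by simp
  moreover have "supp X - supp X' \<noteq> {}" "finite (supp X - supp X')" using X(5,9) by auto
  ultimately have "card (supp X - supp X') = 1" by (metis One_nat_def Suc_le_eq card_gt_0_iff le_antisym)
  moreover have "A - B = supp X - supp X'" using full[OF A] full[OF B] X(8) by auto
  ultimately show ?thesis using embracing_exchangeI[OF e A B] by simp
qed

lemma uniform_skeleton_walk:
  assumes e: "e \<in> E"
    and uniform: "\<forall>X\<in>e_pos_circuits E \<C> e. card (supp X) = om_rank E \<C> + 1"
    and A: "embraces_via e X A"
    and "embraces_via e X' B" "(X, X') \<in> skeleton_adj E \<C> e ^^ Suc n"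
  shows "(A, B) \<in> embracing_exchange E \<C> e ^^ Suc n"
  using assms(4,5)
proof (induction n arbitrary: X' B)
  case 0
  then show ?case using uniform_edge_is_exchange[OF e _ uniform A] by simp
next
  case (Suc n)
  then obtain V where V: "(X, V) \<in> skeleton_adj E \<C> e ^^ Suc n" "(V, X') \<in> skeleton_adj E \<C> e"
    by (metis relpow_Suc_E)
  then obtain D where D: "embraces_via e V D" using skeleton_adjD(1) embraces_via_exists by metis
  show ?case
    using Suc.IH[OF D V(1)] uniform_edge_is_exchange[OF e V(2) uniform D Suc.prems(1)]
    by (rule relpow_Suc_I)
qed

end

section \<open>Comparison of the two distances\<close>

theorem theorem1p3:
  fixes E :: "'a set" and \<C> :: "('a \<Rightarrow> int) set" and e :: 'a and B B' :: "'a set" and r :: nat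
  assumes "oriented_matroid E \<C>"
    and "om_rank E \<C> = r" and "r \<ge> 1"
    and "e \<in> E"
    and "e_embracing E \<C> e B" and "e_embracing E \<C> e B'"
  shows "(fund_circuit \<C> B e = fund_circuit \<C> B' e \<longrightarrow>
            embracing_dist E \<C> e B B' = enat (card (B - B'))) \<and>
         (fund_circuit \<C> B e \<noteq> fund_circuit \<C> B' e \<longrightarrow>
            skeleton_dist E \<C> e (fund_circuit \<C> B e) (fund_circuit \<C> B' e)
              \<le> embracing_dist E \<C> e B B' \<and>
            embracing_dist E \<C> e B B'
              \<le> enat r * skeleton_dist E \<C> e (fund_circuit \<C> B e) (fund_circuit \<C> B' e) \<and>
            ((\<forall>X\<in>e_pos_circuits E \<C> e. card (supp X) = r + 1) \<longrightarrow>
              embracing_dist E \<C> e B B'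
                = skeleton_dist E \<C> e (fund_circuit \<C> B e) (fund_circuit \<C> B' e)))"
proof -
  interpret oriented_matroid E \<C> by fact
  note e = \<open>e \<in> E\<close>
  define X where "X = fund_circuit \<C> B e"
  define X' where "X' = fund_circuit \<C> B' e"
  let ?R = "embracing_exchange E \<C> e" and ?S = "skeleton_adj E \<C> e"
  have B: "embraces_via e X B" and B': "embraces_via e X' B'"
    using assms(5,6) by (auto simp: X_def X'_def embraces_via_iff[OF e])
  have same: "walk_dist ?R B B' = enat (card (B - B'))" if "X = X'"
  proof (rule antisym)
    show upper: "walk_dist ?R B B' \<le> enat (card (B - B'))"
      using B' that by (intro walk_dist_le walk_within_circuit[OF e B]) simp
    have "finite B" using B finite_indep[OF basisD] by (simp add: embraces_via_def)
    obtain k where "(B, B') \<in> ?R ^^ k" "walk_dist ?R B B' = enat k"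
      using upper walk_dist_attained[of ?R B B'] by (metis infinity_ileE)
    then show "enat (card (B - B')) \<le> walk_dist ?R B B'"
      using card_diff_le_walk_length[OF e \<open>finite B\<close>] by simp
  qed
  have lower: "walk_dist ?S X X' \<le> walk_dist ?R B B'"
    using skeleton_walk_of_exchanges[OF e B B'] by (rule walk_dist_le_of_shorter_walks)
  have pos: "\<exists>n. k = Suc n" if "X \<noteq> X'" "(X, X') \<in> ?S ^^ k" for k
    using that by (cases k) auto
  have upper: "walk_dist ?R B B' \<le> enat r * walk_dist ?S X X'" if "X \<noteq> X'"
  proof (rule walk_dist_le_of_walks)
    show "\<exists>j\<le>r * k. (B, B') \<in> ?R ^^ j" if "(X, X') \<in> ?S ^^ k" for k
      using pos[OF \<open>X \<noteq> X'\<close> that] that exchanges_over_skeleton_walk[OF e B B'] assms(2) by blast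
  qed fact
  have "walk_dist ?R B B' \<le> walk_dist ?S X X'"
    if "X \<noteq> X'" and uniform: "\<forall>X\<in>e_pos_circuits E \<C> e. card (supp X) = r + 1"
  proof (rule walk_dist_le_of_shorter_walks)
    show "\<exists>j\<le>k. (B, B') \<in> ?R ^^ j" if "(X, X') \<in> ?S ^^ k" for k
      using pos[OF \<open>X \<noteq> X'\<close> that] that uniform_skeleton_walk[OF e _ B B'] uniform assms(2)
      by (metis le_refl)
  qed
  then have "walk_dist ?R B B' = walk_dist ?S X X'"
    if "X \<noteq> X'" "\<forall>X\<in>e_pos_circuits E \<C> e. card (supp X) = r + 1"
    using that lower by (simp add: antisym)
  then show ?thesis
    using same lower upper
    unfolding embracing_dist_def skeleton_dist_def X_def X'_def by blast
qed

end
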